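(* Let $\mathbb{F}$ be a field and $d \geq 0$ an integer. Consider the following sets: (i) the normalized solid invertible matrices in $\mathrm{Mat}_{d+1}(\mathbb{F})$; (ii) the isomorphism classes of idempotent systems over $\mathbb{F}$ with diameter $d$. For $R$ in (i) let $[\Phi_R]$ be the isomorphism class of the idempotent system $\Phi_R = (\{\Delta_{i,i}\}_{i=0}^d; \{R\Delta_{i,i}R^{-1}\}_{i=0}^d)$ in $\mathrm{Mat}_{d+1}(\mathbb{F})$. Then the map $R \mapsto [\Phi_R]$ is a bijection from (i) to (ii).
   Context: All algebras are associative, unital, over $\mathbb{F}$. $\mathrm{Mat}_{d+1}(\mathbb{F})$ is the algebra of $(d+1)\times(d+1)$ matrices over $\mathbb{F}$, with rows and columns indexed by $0,1,\ldots,d$. $\Delta_{i,j}$ is the matrix with $(i,j)$-entry $1$ and all other entries $0$. Let $\mathcal{A}$ be an algebra isomorphic to $\mathrm{Mat}_{d+1}(\mathbb{F})$ (rank of an element means the rank of its image under such an isomorphism). A system of mutually orthogonal rank $1$ idempotents in $\mathcal{A}$ is a sequence $\{E_i\}_{i=0}^d$ with $E_iE_j = \delta_{i,j}E_i$ and $\mathrm{rank}(E_i)=1$ for $0\le i,j\le d$. An idempotent system in $\mathcal{A}$ is a sequence $\Phi = (\{E_i\}_{i=0}^d; \{E^*_i\}_{i=0}^d)$ such that (i) $\{E_i\}_{i=0}^d$ and (ii) $\{E^*_i\}_{i=0}^d$ are systems of mutually orthogonal rank $1$ idempotents in $\mathcal{A}$; (iii) $E_0E^*_iE_0 \neq 0$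 for $0\le i\le d$; (iv) $E^*_0E_iE^*_0\neq 0$ for $0\le i\le d$. Such $\Phi$ is said to be over $\mathbb{F}$ with diameter $d$. An isomorphism of idempotent systems from $\Phi$ (in $\mathcal{A}$) to $\Phi'$ (in $\mathcal{A}'$) is an algebra isomorphism $\mathcal{A}\to\mathcal{A}'$ sending $E_i\mapsto E'_i$ and $E^*_i\mapsto E^{*\prime}_i$ for $0\le i\le d$. An invertible $R\in\mathrm{Mat}_{d+1}(\mathbb{F})$ is solid if for both $R$ and $R^{-1}$ all entries in column $0$ and in row $0$ are nonzero. A solid invertible $R$ is normalized if all entries in column $0$ of $R$ are equal to $1$ and all entries in column $0$ of $R^{-1}$ are the same. For solid invertible $R$, $\Phi_R$ is an idempotent system in $\mathrm{Mat}_{d+1}(\mathbb{F})$. *)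

theory Defs
  imports
    "Jordan_Normal_Form.DL_Rank"
    "HOL-Algebra.QuotRing"
begin

(* Associative unital algebras over K, not necessarily commutative: the locale algebra of
   HOL-Algebra requires commutative multiplication, so it cannot be used here.  The field F
   is the type 'a::field, seen as the HOL-Algebra ring class_ring. *)
locale assoc_algebra = Module.module K A + ring A
  for K :: "('k, 'm) ring_scheme" and A :: "('k, 'b) module" +
  assumes smult_mult_left:
    "\<lbrakk>a \<in> carrier K; x \<in> carrier A; y \<in> carrier A\<rbrakk>
      \<Longrightarrow> (a \<odot>\<^bsub>A\<^esub> x) \<otimes>\<^bsub>A\<^esub> y = a \<odot>\<^bsub>A\<^esub> (x \<otimes>\<^bsub>A\<^esub> y)"
  and smult_mult_right:
    "\<lbrakk>a \<in> carrier K; x \<in> carrier A; y \<in> carrier A\<rbrakk>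
      \<Longrightarrow> x \<otimes>\<^bsub>A\<^esub> (a \<odot>\<^bsub>A\<^esub> y) = a \<odot>\<^bsub>A\<^esub> (x \<otimes>\<^bsub>A\<^esub> y)"

abbreviation is_algebra :: "('a::field, 'b) module \<Rightarrow> bool" where
  "is_algebra \<equiv> assoc_algebra (class_ring :: 'a ring)"

definition alg_iso :: "('a::field, 'b) module \<Rightarrow> ('a, 'c) module \<Rightarrow> ('b \<Rightarrow> 'c) set" where
  "alg_iso A B =
    {f \<in> ring_iso A B. \<forall>a. \<forall>x \<in> carrier A. f (a \<odot>\<^bsub>A\<^esub> x) = a \<odot>\<^bsub>B\<^esub> f x}"

abbreviation Mat_alg :: "nat \<Rightarrow> ('a::field, 'a mat) module" where
  "Mat_alg d \<equiv> module_mat TYPE('a) (d + 1) (d + 1)"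

(* The rank does not depend on the chosen isomorphism: any two differ by an algebra
   automorphism of the matrix algebra, which is inner (Skolem-Noether). *)
definition alg_rank :: "nat \<Rightarrow> ('a::field, 'b) module \<Rightarrow> 'b \<Rightarrow> nat" where
  "alg_rank d A x = vec_space.rank (d + 1) ((SOME f. f \<in> alg_iso A (Mat_alg d)) x)"

definition orth_rank1_idempotents ::
  "nat \<Rightarrow> ('a::field, 'b) module \<Rightarrow> (nat \<Rightarrow> 'b) \<Rightarrow> bool" where
  "orth_rank1_idempotents d A E \<longleftrightarrow>
    (\<forall>i\<le>d. E i \<in> carrier A) \<and>
    (\<forall>i\<le>d. \<forall>j\<le>d. E i \<otimes>\<^bsub>A\<^esub> E j = (if i = j then E i else \<zero>\<^bsub>A\<^esub>)) \<and>
    (\<forall>i\<le>d. alg_rank d A (E i) = 1)"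

(* A pair of sequences in an algebra.  Only the terms with index at most d matter below;
   the others are irrelevant to all predicates and to isomorphism. *)
record ('a, 'b) idem_pair =
  ambient :: "('a, 'b) module"
  idem :: "nat \<Rightarrow> 'b"
  dual_idem :: "nat \<Rightarrow> 'b"

definition idempotent_system :: "nat \<Rightarrow> ('a::field, 'b) idem_pair \<Rightarrow> bool" where
  "idempotent_system d \<Phi> \<longleftrightarrow>
    (let A = ambient \<Phi>; E = idem \<Phi>; E' = dual_idem \<Phi> in
      is_algebra A \<and> alg_iso A (Mat_alg d) \<noteq> {} \<and>
      orth_rank1_idempotents d A E \<and>
      orth_rank1_idempotents d A E' \<and>
      (\<forall>i\<le>d. E 0 \<otimes>\<^bsub>A\<^esub> E' i \<otimes>\<^bsub>A\<^esub> E 0 \<noteq> \<zero>\<^bsub>A\<^esub>) \<and>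
      (\<forall>i\<le>d. E' 0 \<otimes>\<^bsub>A\<^esub> E i \<otimes>\<^bsub>A\<^esub> E' 0 \<noteq> \<zero>\<^bsub>A\<^esub>))"

definition idem_isomorphic ::
  "nat \<Rightarrow> ('a::field, 'b) idem_pair \<Rightarrow> ('a, 'c) idem_pair \<Rightarrow> bool" where
  "idem_isomorphic d \<Phi> \<Psi> \<longleftrightarrow>
    (\<exists>f \<in> alg_iso (ambient \<Phi>) (ambient \<Psi>).
      \<forall>i\<le>d. f (idem \<Phi> i) = idem \<Psi> i \<and> f (dual_idem \<Phi> i) = dual_idem \<Psi> i)"

(* The algebras in which idempotent systems live form a proper class, so the set of
   isomorphism classes is taken relative to a carrier type 'b.  With 'b = 'a mat every
   idempotent system over 'a with diameter d, in an algebra on any type, has an isomorphic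
   copy, since its algebra is isomorphic to the matrix algebra. *)
definition idem_systems :: "nat \<Rightarrow> ('a::field, 'b) idem_pair set" where
  "idem_systems d = {\<Phi>. idempotent_system d \<Phi>}"

definition idem_iso_rel :: "nat \<Rightarrow> (('a::field, 'b) idem_pair \<times> ('a, 'b) idem_pair) set" where
  "idem_iso_rel d =
    {(\<Phi>, \<Psi>). \<Phi> \<in> idem_systems d \<and> \<Psi> \<in> idem_systems d \<and> idem_isomorphic d \<Phi> \<Psi>}"

abbreviation idem_iso_class :: "nat \<Rightarrow> ('a::field, 'b) idem_pair \<Rightarrow> ('a, 'b) idem_pair set" where
  "idem_iso_class d \<Phi> \<equiv> idem_iso_rel d `` {\<Phi>}"

abbreviation idem_iso_classes :: "nat \<Rightarrow> ('a::field, 'b) idem_pair set set" where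
  "idem_iso_classes d \<equiv> idem_systems d // idem_iso_rel d"

abbreviation Mat_inv :: "nat \<Rightarrow> 'a::field mat \<Rightarrow> 'a mat" where
  "Mat_inv d R \<equiv> inv\<^bsub>Mat_alg d\<^esub> R"

definition solid_invertible :: "nat \<Rightarrow> 'a::field mat \<Rightarrow> bool" where
  "solid_invertible d R \<longleftrightarrow>
    R \<in> Units (Mat_alg d) \<and>
    (\<forall>M \<in> {R, Mat_inv d R}. \<forall>i\<le>d. M $$ (i, 0) \<noteq> 0 \<and> M $$ (0, i) \<noteq> 0)"

definition normalized_solid_invertible :: "nat \<Rightarrow> 'a::field mat set" where
  "normalized_solid_invertible d =
    {R. solid_invertible d R \<and>
        (\<forall>i\<le>d. R $$ (i, 0) = 1) \<and>
        (\<forall>i\<le>d. \<forall>j\<le>d. Mat_inv d R $$ (i, 0) = Mat_inv d R $$ (j, 0))}"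

definition Delta :: "nat \<Rightarrow> nat \<Rightarrow> nat \<Rightarrow> 'a::field mat" where
  "Delta d i j = mat (d + 1) (d + 1) (\<lambda>(r, c). if r = i \<and> c = j then 1 else 0)"

definition Phi :: "nat \<Rightarrow> 'a::field mat \<Rightarrow> ('a, 'a mat) idem_pair" where
  "Phi d R = \<lparr>ambient = Mat_alg d,
              idem = (\<lambda>i. Delta d i i),
              dual_idem = (\<lambda>i. R * Delta d i i * Mat_inv d R)\<rparr>"

lemma is_algebra_Mat_alg: "is_algebra (Mat_alg d :: ('a::field, 'a mat) module)"
proof -
  have r: "ring (Mat_alg d :: ('a, 'a mat) module)"
    using ring_mat[where 'a = 'a and n = "d + 1" and b = "\<lparr>smult = (\<cdot>\<^sub>m) :: 'a \<Rightarrow> _\<rparr>"]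
    by (simp add: ring_mat_def module_mat_def)
  have m: "Module.module (class_ring :: 'a ring) (Mat_alg d)"
    by (rule Module.moduleI)
      (auto simp: class_ring_simps module_mat_simps abelian_group_mat
        field.is_ring cring_def class_field[THEN field.axioms(1), THEN domain.axioms(1)]
        class_field[THEN field.axioms(1), THEN domain.axioms(1), THEN cring.axioms(1)]
        class_field[THEN field.axioms(1), THEN domain.axioms(1), THEN cring.axioms(2)]
        add_smult_distrib_right_mat add_smult_distrib_left_mat)
  show ?thesis
    by (intro assoc_algebra.intro m r assoc_algebra_axioms.intro)
      (auto simp: module_mat_simps)
qed

lemma alg_iso_id: "(\<lambda>x. x) \<in> alg_iso A A"
  by (auto simp: alg_iso_def ring_iso_def Ring.ring_hom_def bij_betw_def)

lemma alg_iso_comp: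
  "f \<in> alg_iso A B \<Longrightarrow> g \<in> alg_iso B C \<Longrightarrow> g \<circ> f \<in> alg_iso A C"
  unfolding alg_iso_def ring_iso_def
  by (auto simp: Ring.ring_hom_def Pi_iff intro: bij_betw_trans)

lemma alg_iso_inv:
  assumes "is_algebra A" and f: "f \<in> alg_iso A B"
  shows "inv_into (carrier A) f \<in> alg_iso B A"
proof -
  interpret A: assoc_algebra class_ring A by fact
  have r: "f \<in> ring_iso A B" and b: "bij_betw f (carrier A) (carrier B)"
    using f by (auto simp: alg_iso_def ring_iso_def)
  have "inv_into (carrier A) f (a \<odot>\<^bsub>B\<^esub> y) = a \<odot>\<^bsub>A\<^esub> inv_into (carrier A) f y"
    if y: "y \<in> carrier B" for a y
  proof -
    let ?x = "inv_into (carrier A) f y"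
    have x: "?x \<in> carrier A" "f ?x = y"
      using b y by (auto simp: bij_betw_def inv_into_into f_inv_into_f)
    have "f (a \<odot>\<^bsub>A\<^esub> ?x) = a \<odot>\<^bsub>B\<^esub> y"
      using f x by (simp add: alg_iso_def)
    moreover have "a \<odot>\<^bsub>A\<^esub> ?x \<in> carrier A"
      using x(1) A.smult_closed by (simp add: class_ring_simps)
    ultimately show ?thesis
      using b by (metis bij_betw_def inv_into_f_f)
  qed
  moreover have "inv_into (carrier A) f \<in> ring_iso B A"
    using ring_iso_set_sym[OF A.ring_axioms r] .
  ultimately show ?thesis by (simp add: alg_iso_def)
qed

lemma equiv_idem_iso_rel:
  "equiv (idem_systems d) (idem_iso_rel d :: (('a::field, 'b) idem_pair \<times> _) set)"
proof (rule equivI)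
  show "idem_iso_rel d \<subseteq> idem_systems d \<times> idem_systems d"
    by (auto simp: idem_iso_rel_def)
  show "refl_on (idem_systems d) (idem_iso_rel d)"
    using alg_iso_id by (fastforce simp: refl_on_def idem_iso_rel_def idem_isomorphic_def)
  show "trans (idem_iso_rel d :: (('a, 'b) idem_pair \<times> _) set)"
  proof (rule transI)
    fix \<Phi> \<Psi> \<Omega> :: "('a, 'b) idem_pair"
    assume 1: "(\<Phi>, \<Psi>) \<in> idem_iso_rel d" and 2: "(\<Psi>, \<Omega>) \<in> idem_iso_rel d"
    obtain f where f: "f \<in> alg_iso (ambient \<Phi>) (ambient \<Psi>)"
      "\<forall>i\<le>d. f (idem \<Phi> i) = idem \<Psi> i \<and> f (dual_idem \<Phi> i) = dual_idem \<Psi> i"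
      using 1 by (auto simp: idem_iso_rel_def idem_isomorphic_def)
    obtain g where g: "g \<in> alg_iso (ambient \<Psi>) (ambient \<Omega>)"
      "\<forall>i\<le>d. g (idem \<Psi> i) = idem \<Omega> i \<and> g (dual_idem \<Psi> i) = dual_idem \<Omega> i"
      using 2 by (auto simp: idem_iso_rel_def idem_isomorphic_def)
    have "idem_isomorphic d \<Phi> \<Omega>"
      unfolding idem_isomorphic_def using alg_iso_comp[OF f(1) g(1)] f(2) g(2)
      by (intro bexI[of _ "g \<circ> f"]) auto
    then show "(\<Phi>, \<Omega>) \<in> idem_iso_rel d"
      using 1 2 by (simp add: idem_iso_rel_def)
  qed
  show "sym (idem_iso_rel d :: (('a, 'b) idem_pair \<times> _) set)"
  proof (rule symI)
    fix \<Phi> \<Psi> :: "('a, 'b) idem_pair"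
    assume "(\<Phi>, \<Psi>) \<in> idem_iso_rel d"
    then obtain f where s: "\<Phi> \<in> idem_systems d" "\<Psi> \<in> idem_systems d"
      and f: "f \<in> alg_iso (ambient \<Phi>) (ambient \<Psi>)"
      and fi: "\<forall>i\<le>d. f (idem \<Phi> i) = idem \<Psi> i \<and> f (dual_idem \<Phi> i) = dual_idem \<Psi> i"
      by (auto simp: idem_iso_rel_def idem_isomorphic_def)
    let ?A = "ambient \<Phi>"
    have A: "is_algebra ?A"
      and c: "\<forall>i\<le>d. idem \<Phi> i \<in> carrier ?A \<and> dual_idem \<Phi> i \<in> carrier ?A"
      using s by (auto simp: idem_systems_def idempotent_system_def orth_rank1_idempotents_def Let_def)
    have i: "inj_on f (carrier ?A)"
      using f by (auto simp: alg_iso_def ring_iso_def bij_betw_def)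
    have "\<forall>i\<le>d. inv_into (carrier ?A) f (idem \<Psi> i) = idem \<Phi> i \<and>
        inv_into (carrier ?A) f (dual_idem \<Psi> i) = dual_idem \<Phi> i"
      using fi c inv_into_f_f[OF i] by force
    then show "(\<Psi>, \<Phi>) \<in> idem_iso_rel d"
      using s alg_iso_inv[OF A f] by (auto simp: idem_iso_rel_def idem_isomorphic_def)
  qed
qed

end

theory Submission
  imports Defs
begin

text \<open>A nonzero idempotent \<open>e\<close> of the matrix algebra has rank one iff \<open>e x e\<close> is a scalar multiple
  of \<open>e\<close> for every \<open>x\<close>. This property is preserved by algebra isomorphisms, so the choice of
  isomorphism in the rank plays no role and Skolem-Noether is not needed.

  Writing mutually orthogonal rank one idempotents as outer products of vectors yields an invertible
  \<open>U\<close> with \<open>E\<^sub>i = U \<Delta>\<^sub>i\<^sub>i U\<^sup>-\<^sup>1\<close>, so every idempotent system is isomorphic to some \<open>\<Phi>\<^sub>W\<close>, and the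
  nonvanishing conditions say exactly that \<open>W\<close> is solid. Rescaling the columns of \<open>W\<close> does not
  change \<open>\<Phi>\<^sub>W\<close>, and rescaling its rows amounts to conjugation by a diagonal matrix, which fixes
  every \<open>\<Delta>\<^sub>i\<^sub>i\<close>; this allows \<open>W\<close> to be normalized.

  Conversely, an isomorphism from \<open>\<Phi>\<^sub>R\<close> to \<open>\<Phi>\<^sub>S\<close> multiplies the entry \<open>(k, l)\<close> of a matrix by a
  constant \<open>c\<^sub>k\<^sub>l\<close> with \<open>c\<^sub>l\<^sub>l = 1\<close>. If \<open>R\<close> and \<open>S\<close> are normalized, comparing the images of
  \<open>R \<Delta>\<^sub>0\<^sub>0 R\<^sup>-\<^sup>1\<close> shows that \<open>c\<^sub>k\<^sub>l\<close> does not depend on \<open>k\<close>, hence is \<open>1\<close>, and then \<open>R = S\<close>.\<close>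

section \<open>Matrix units and inverses in the matrix algebra\<close>

declare module_mat_simps [simp]

lemma Delta_carrier [simp]: "Delta d i j \<in> carrier_mat (Suc d) (Suc d)"
  by (simp add: Delta_def)

lemma Delta_index [simp]:
  "r \<le> d \<Longrightarrow> c \<le> d \<Longrightarrow> Delta d i j $$ (r, c) = (if r = i \<and> c = j then 1 else 0)"
  by (simp add: Delta_def less_Suc_eq_le)

lemma mat_neq_zero_iff:
  assumes "M \<in> carrier_mat n m"
  shows "M \<noteq> 0\<^sub>m n m \<longleftrightarrow> (\<exists>i<n. \<exists>j<m. M $$ (i, j) \<noteq> 0)"
  using assms by (auto simp: mat_eq_iff)

lemma mult_mat_index:
  assumes "A \<in> carrier_mat n m" "B \<in> carrier_mat m k" "i < n" "j < k"
  shows "(A * B) $$ (i, j) = (\<Sum>l<m. A $$ (i, l) * B $$ (l, j))"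
  using assms by (simp add: scalar_prod_def atLeast0LessThan)

lemma mult_Delta_index:
  fixes X :: "'a::field mat"
  assumes X: "X \<in> carrier_mat (Suc d) (Suc d)" and "k \<le> d" "l \<le> d" "i \<le> d" "j \<le> d"
  shows "(X * Delta d k l) $$ (i, j) = (if j = l then X $$ (i, k) else 0)"
proof -
  have "(X * Delta d k l) $$ (i, j) =
      (\<Sum>m<Suc d. X $$ (i, m) * Delta d k l $$ (m, j))"
    using assms by (intro mult_mat_index[of _ _ "Suc d" _ "Suc d"]) auto
  also have "\<dots> = (\<Sum>m<Suc d. if m = k then (if j = l then X $$ (i, k) else 0) else 0)"
    using assms by (intro sum.cong) auto
  finally show ?thesis
    using assms by (simp del: sum.lessThan_Suc)
qed

text \<open>The product is the outer product of column \<open>k\<close> of \<open>X\<close> and row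
  \<open>l\<close> of \<open>Y\<close>. Later entry computations with
  \<open>R * Delta d i i * Mat_inv d R\<close> rest on this factorization.\<close>

lemma mult_Delta_mult_index:
  fixes X Y :: "'a::field mat"
  assumes X: "X \<in> carrier_mat (Suc d) (Suc d)" and Y: "Y \<in> carrier_mat (Suc d) (Suc d)"
    and "k \<le> d" "l \<le> d" "i \<le> d" "j \<le> d"
  shows "(X * Delta d k l * Y) $$ (i, j) = X $$ (i, k) * Y $$ (l, j)"
proof -
  have "(X * Delta d k l * Y) $$ (i, j) =
      (\<Sum>m<Suc d. (X * Delta d k l) $$ (i, m) * Y $$ (m, j))"
    using assms by (intro mult_mat_index[of _ _ "Suc d"] mult_carrier_mat[of _ _ "Suc d"]) auto
  also have "\<dots> = (\<Sum>m<Suc d. if m = l then X $$ (i, k) * Y $$ (l, j) else 0)"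
    using assms by (intro sum.cong) (auto simp: mult_Delta_index)
  finally show ?thesis
    using assms by (simp del: sum.lessThan_Suc)
qed

lemma Delta_mult_Delta_index:
  fixes X :: "'a::field mat"
  assumes "X \<in> carrier_mat (Suc d) (Suc d)" "k \<le> d" "l \<le> d" "i \<le> d" "j \<le> d" "p \<le> d" "q \<le> d"
  shows "(Delta d p k * X * Delta d l q) $$ (i, j) =
    (if i = p \<and> j = q then X $$ (k, l) else 0)"
proof -
  \<comment> \<open>A left factor \<open>1\<^sub>m (Suc d)\<close> makes
    \<open>Delta d p k * X\<close> an instance of the outer product formula.\<close>
  have "(Delta d p k * X) $$ (i, l) = (if i = p then X $$ (k, l) else 0)"
    using mult_Delta_mult_index[of "1\<^sub>m (Suc d)" d X p k i l] assms
    by (auto simp: left_mult_one_mat[of _ "Suc d" "Suc d"])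
  then show ?thesis
    using assms by (subst mult_Delta_index) (auto intro!: mult_carrier_mat[of _ _ "Suc d"])
qed

text \<open>Over a field a one-sided inverse of a square matrix is two-sided, so one product
  identity determines the inverse in the ring \<open>Mat_alg d\<close>.\<close>

lemma Mat_inv_eqI:
  assumes "X \<in> carrier_mat (Suc d) (Suc d)" "Y \<in> carrier_mat (Suc d) (Suc d)"
    and "X * Y = 1\<^sub>m (Suc d)"
  shows "X \<in> Units (Mat_alg d)" "Mat_inv d (X :: 'a::field mat) = Y"
proof -
  interpret assoc_algebra class_ring "Mat_alg d :: ('a, 'a mat) module"
    by (rule is_algebra_Mat_alg)
  have YX: "Y * X = 1\<^sub>m (Suc d)"
    using assms by (rule mat_mult_left_right_inverse)
  show "X \<in> Units (Mat_alg d)"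
    using assms YX by (auto simp: Units_def)
  show "Mat_inv d X = Y"
    using assms YX by (intro inv_char) auto
qed

lemma Mat_inv_props:
  assumes "X \<in> Units (Mat_alg d)"
  shows "X \<in> carrier_mat (Suc d) (Suc d)" "Mat_inv d X \<in> carrier_mat (Suc d) (Suc d)"
    and "X * Mat_inv d X = 1\<^sub>m (Suc d)" "Mat_inv d (X :: 'a::field mat) * X = 1\<^sub>m (Suc d)"
proof -
  interpret assoc_algebra class_ring "Mat_alg d :: ('a, 'a mat) module"
    by (rule is_algebra_Mat_alg)
  show "X \<in> carrier_mat (Suc d) (Suc d)" "Mat_inv d X \<in> carrier_mat (Suc d) (Suc d)"
    "X * Mat_inv d X = 1\<^sub>m (Suc d)" "Mat_inv d X * X = 1\<^sub>m (Suc d)"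
    using Units_closed[OF assms] Units_inv_closed[OF assms] Units_r_inv[OF assms]
      Units_l_inv[OF assms] by simp_all
qed

section \<open>Algebra isomorphisms and conjugation\<close>

lemma alg_isoD:
  assumes "f \<in> alg_iso A B"
  shows "x \<in> carrier A \<Longrightarrow> f x \<in> carrier B"
    and "\<lbrakk>x \<in> carrier A; y \<in> carrier A\<rbrakk> \<Longrightarrow> f (x \<otimes>\<^bsub>A\<^esub> y) = f x \<otimes>\<^bsub>B\<^esub> f y"
    and "x \<in> carrier A \<Longrightarrow> f (a \<odot>\<^bsub>A\<^esub> x) = a \<odot>\<^bsub>B\<^esub> f x"
    and "inj_on f (carrier A)" and "f ` carrier A = carrier B"
  using assms by (auto simp: alg_iso_def ring_iso_def Ring.ring_hom_def bij_betw_def)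

lemma alg_iso_zero:
  assumes "is_algebra A" "is_algebra B" "f \<in> alg_iso A B"
  shows "f \<zero>\<^bsub>A\<^esub> = \<zero>\<^bsub>B\<^esub>"
proof -
  interpret A: assoc_algebra class_ring A by fact
  interpret B: assoc_algebra class_ring B by fact
  show ?thesis
    using assms(3) ring_hom_zero[OF _ A.ring_axioms B.ring_axioms]
    by (auto simp: alg_iso_def ring_iso_def)
qed

text \<open>The inverse map is conjugation the other way, \<open>Q * x * P\<close>. Such maps serve
  below to diagonalize the first idempotent sequence and to rescale rows.\<close>

lemma alg_iso_conj:
  fixes P Q :: "'a::field mat"
  assumes P: "P \<in> carrier_mat (Suc d) (Suc d)" and Q: "Q \<in> carrier_mat (Suc d) (Suc d)"
    and PQ: "P * Q = 1\<^sub>m (Suc d)"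
  shows "(\<lambda>x. P * x * Q) \<in> alg_iso (Mat_alg d) (Mat_alg d)"
proof -
  have QP: "Q * P = 1\<^sub>m (Suc d)"
    using P Q PQ by (rule mat_mult_left_right_inverse)
  note cl = mult_carrier_mat[of _ "Suc d" "Suc d" _ "Suc d"]
  note as = assoc_mult_mat[of _ "Suc d" "Suc d" _ "Suc d" _ "Suc d"]
  \<comment> \<open>With products associated to the right, these rules cancel adjacent mutually
    inverse factors.\<close>
  have canc: "Q * (P * Z) = Z" "P * (Q * Z) = Z" if "Z \<in> carrier_mat (Suc d) (Suc d)" for Z
    using that P Q PQ QP as[of Q P Z] as[of P Q Z] by simp_all
  have "bij_betw (\<lambda>x. P * x * Q) (carrier_mat (Suc d) (Suc d)) (carrier_mat (Suc d) (Suc d))"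
    by (rule bij_betw_byWitness[of _ "\<lambda>x. Q * x * P"])
      (use P Q PQ QP canc in \<open>auto simp: as cl\<close>)
  moreover have "P * (x * y) * Q = P * x * Q * (P * y * Q)"
    if "x \<in> carrier_mat (Suc d) (Suc d)" "y \<in> carrier_mat (Suc d) (Suc d)" for x y
    using that P Q canc by (simp add: as cl)
  moreover have "P * (x + y) * Q = P * x * Q + P * y * Q"
    if "x \<in> carrier_mat (Suc d) (Suc d)" "y \<in> carrier_mat (Suc d) (Suc d)" for x y
    using that P Q mult_add_distrib_mat[OF P that]
      add_mult_distrib_mat[OF cl[OF P that(1)] cl[OF P that(2)] Q] by simp
  moreover have "P * (a \<cdot>\<^sub>m x) * Q = a \<cdot>\<^sub>m (P * x * Q)"
    if "x \<in> carrier_mat (Suc d) (Suc d)" for x a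
    using that P Q
    by (simp add: cl mult_smult_distrib[of _ "Suc d" "Suc d"] mult_smult_assoc_mat[of _ "Suc d" "Suc d"])
  ultimately show ?thesis
    using P Q PQ cl
    by (auto simp: alg_iso_def ring_iso_def Ring.ring_hom_def)
qed

section \<open>Rank one matrices and minimal idempotents\<close>

text \<open>In a matrix of rank one every column is a multiple of a fixed nonzero column
  \<open>b\<close>; the multipliers form \<open>v\<close>. Conversely, an outer product has rank at
  most one, and a nonzero column gives an independent set of size one.\<close>

lemma rank_one_iff_outer_product:
  fixes M :: "'a::field mat"
  assumes M: "M \<in> carrier_mat n n"
  shows "vec_space.rank n M = 1 \<longleftrightarrow>
    M \<noteq> 0\<^sub>m n n \<and> (\<exists>u v. \<forall>i<n. \<forall>j<n. M $$ (i, j) = u i * v j)"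
proof -
  interpret vec_space "TYPE('a)" n .
  have nz: "\<exists>a<n. \<exists>b<n. M $$ (a, b) \<noteq> 0" if "M \<noteq> 0\<^sub>m n n"
    using that mat_neq_zero_iff[OF M] by simp
  show ?thesis
  proof (intro iffI; (elim conjE exE)?)
    assume 1: "rank M = 1"
    have "M \<noteq> 0\<^sub>m n n"
      using 1 rank_0I[of n] by auto
    with nz obtain a b where ab: "a < n" "b < n" "M $$ (a, b) \<noteq> 0"
      by blast
    have "\<exists>t. \<forall>i<n. M $$ (i, j) = M $$ (i, b) * t" if j: "j < n" for j
    proof (cases "col M j = col M b")
      case True
      have "M $$ (i, j) = M $$ (i, b)" if "i < n" for i
        using that j ab M True by (metis carrier_matD index_col)
      then show ?thesis by (intro exI[of _ 1]) simp
    next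
      case False
      let ?B = "mat_of_cols n [col M b, col M j]"
      have B: "?B \<in> carrier_mat n 2" by (simp add: mat_of_cols_def numeral_2_eq_2)
      have cB: "cols ?B = [col M b, col M j]"
        using M by (intro cols_mat_of_cols) auto
      \<comment> \<open>The two columns are distinct here, so independence would yield a set of
        cardinality 2 and contradict rank one.\<close>
      have "lin_dep {col M b, col M j}"
      proof (rule ccontr)
        assume "lin_indpt {col M b, col M j}"
        then have "card {col M b, col M j} \<le> rank M"
          using M ab j by (intro rank_ge_card_indpt[of _ n]) (auto simp: cols_def)
        then show False using 1 False by auto
      qed
      then obtain v where v: "v \<in> carrier_vec 2" "v \<noteq> 0\<^sub>v 2" "?B *\<^sub>v v = 0\<^sub>v n"
        using lin_depE[OF B] False cB by auto
      have eq: "M $$ (i, b) * v $ 0 + M $$ (i, j) * v $ 1 = 0" if i: "i < n" for i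
      proof -
        have "(?B *\<^sub>v v) $ i = M $$ (i, b) * v $ 0 + M $$ (i, j) * v $ 1"
          using i v(1) M ab j
          by (auto simp: scalar_prod_def mat_of_cols_def numeral_2_eq_2)
        then show ?thesis using v(3) i by simp
      qed
      \<comment> \<open>If column \<open>j\<close> had coefficient 0 in the relation
        \<open>v\<close>, row \<open>a\<close>, where \<open>M $$ (a, b)\<close> is nonzero, would
        force \<open>v = 0\<close>.\<close>
      have "v $ 1 \<noteq> 0"
      proof
        assume 0: "v $ 1 = 0"
        then have "v $ 0 = 0" using eq[OF ab(1)] ab by simp
        with 0 v show False by (auto simp: less_2_cases_iff)
      qed
      then have "M $$ (i, j) = M $$ (i, b) * (- v $ 0 / v $ 1)" if "i < n" for i
        using eq[OF that] by (simp add: field_simps eq_neg_iff_add_eq_0 add.commute)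
      then show ?thesis by blast
    qed
    then obtain t where "\<forall>j<n. \<forall>i<n. M $$ (i, j) = M $$ (i, b) * t j"
      by metis
    then show "M \<noteq> 0\<^sub>m n n \<and> (\<exists>u v. \<forall>i<n. \<forall>j<n. M $$ (i, j) = u i * v j)"
      using \<open>M \<noteq> 0\<^sub>m n n\<close>
      by (intro conjI exI[of _ "\<lambda>i. M $$ (i, b)"] exI[of _ t]) auto
  next
    fix u v
    assume "M \<noteq> 0\<^sub>m n n" and uv: "\<forall>i<n. \<forall>j<n. M $$ (i, j) = u i * v j"
    with nz obtain a b where ab: "a < n" "b < n" "M $$ (a, b) \<noteq> 0"
      by blast
    have "rank M \<le> 1"
      using M uv by (intro rank_le_1_product_entries[of _ n u v]) auto
    moreover have "lin_indpt {col M b}"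
    proof -
      let ?B = "mat_of_cols n [col M b]"
      have B: "?B \<in> carrier_mat n 1" by (simp add: mat_of_cols_def)
      have cB: "cols ?B = [col M b]"
        using M by (intro cols_mat_of_cols) auto
      show ?thesis
      proof
        assume "lin_dep {col M b}"
        then obtain v where v: "v \<in> carrier_vec 1" "v \<noteq> 0\<^sub>v 1" "?B *\<^sub>v v = 0\<^sub>v n"
          using lin_depE[OF B] cB by auto
        have "(?B *\<^sub>v v) $ a = M $$ (a, b) * v $ 0"
          using v(1) M ab by (auto simp: scalar_prod_def mat_of_cols_def)
        then have "v $ 0 = 0" using v(3) ab by simp
        with v show False by auto
      qed
    qed
    then have "card {col M b} \<le> rank M"
      using M ab by (intro rank_ge_card_indpt[of _ n]) (auto simp: cols_def)
    ultimately show "rank M = 1" by simp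
  qed
qed

text \<open>The last condition says that the corner \<open>e A e\<close> is the line spanned by
  \<open>e\<close>. Only algebra operations occur, which makes the notion invariant under
  isomorphism.\<close>

definition minimal_idem :: "('a::field, 'b) module \<Rightarrow> 'b \<Rightarrow> bool" where
  "minimal_idem A e \<longleftrightarrow> e \<in> carrier A \<and> e \<otimes>\<^bsub>A\<^esub> e = e \<and> e \<noteq> \<zero>\<^bsub>A\<^esub> \<and>
    (\<forall>x \<in> carrier A. \<exists>c. e \<otimes>\<^bsub>A\<^esub> x \<otimes>\<^bsub>A\<^esub> e = c \<odot>\<^bsub>A\<^esub> e)"

lemma minimal_idem_alg_iso:
  assumes A: "is_algebra A" and B: "is_algebra B" and f: "f \<in> alg_iso A B"
    and e: "minimal_idem A e"
  shows "minimal_idem B (f e)"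
proof -
  interpret A: assoc_algebra class_ring A by fact
  note h = alg_isoD[OF f]
  have ec: "e \<in> carrier A" and ee: "e \<otimes>\<^bsub>A\<^esub> e = e" and e0: "e \<noteq> \<zero>\<^bsub>A\<^esub>"
    and em: "\<And>x. x \<in> carrier A \<Longrightarrow> \<exists>c. e \<otimes>\<^bsub>A\<^esub> x \<otimes>\<^bsub>A\<^esub> e = c \<odot>\<^bsub>A\<^esub> e"
    using e by (auto simp: minimal_idem_def)
  have "f e \<noteq> \<zero>\<^bsub>B\<^esub>"
    using inj_onD[OF h(4), of e "\<zero>\<^bsub>A\<^esub>"] alg_iso_zero[OF A B f] ec e0 by auto
  moreover have "f e \<otimes>\<^bsub>B\<^esub> f e = f e"
    using h(2)[OF ec ec] ee by simp
  moreover have "\<exists>c. f e \<otimes>\<^bsub>B\<^esub> y \<otimes>\<^bsub>B\<^esub> f e = c \<odot>\<^bsub>B\<^esub> f e" if "y \<in> carrier B" for y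
  proof -
    have "y \<in> f ` carrier A"
      using that h(5) by simp
    then obtain x where x: "x \<in> carrier A" "y = f x"
      by blast
    obtain c where c: "e \<otimes>\<^bsub>A\<^esub> x \<otimes>\<^bsub>A\<^esub> e = c \<odot>\<^bsub>A\<^esub> e"
      using em[OF x(1)] ..
    have "f e \<otimes>\<^bsub>B\<^esub> y \<otimes>\<^bsub>B\<^esub> f e = f (e \<otimes>\<^bsub>A\<^esub> x \<otimes>\<^bsub>A\<^esub> e)"
      unfolding x(2) h(2)[OF A.m_closed[OF ec x(1)] ec] h(2)[OF ec x(1)] ..
    also have "\<dots> = c \<odot>\<^bsub>B\<^esub> f e"
      unfolding c by (rule h(3)[OF ec])
    finally show ?thesis by blast
  qed
  ultimately show ?thesis
    using h(1)[OF ec] unfolding minimal_idem_def by blast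
qed

text \<open>Testing minimality on a single well-chosen matrix unit already exhibits \<open>M\<close>
  as an outer product. Conversely, if \<open>M\<close> is the outer product of \<open>u\<close> and
  \<open>v\<close>, then \<open>M * X * M\<close> is \<open>M\<close> times the scalar obtained by
  pairing \<open>v\<close> with \<open>X\<close> applied to \<open>u\<close>.\<close>

lemma minimal_idem_Mat_iff:
  fixes M :: "'a::field mat"
  assumes M: "M \<in> carrier_mat (Suc d) (Suc d)" and MM: "M * M = M"
  shows "minimal_idem (Mat_alg d) M \<longleftrightarrow> vec_space.rank (Suc d) M = 1"
proof
  assume m: "minimal_idem (Mat_alg d) M"
  then have "M \<noteq> 0\<^sub>m (Suc d) (Suc d)"
    by (simp add: minimal_idem_def)
  then obtain a b where ab: "a \<le> d" "b \<le> d" "M $$ (a, b) \<noteq> 0"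
    using mat_neq_zero_iff[OF M] by (auto simp: less_Suc_eq_le)
  \<comment> \<open>The indices of the matrix unit are swapped so that
    \<open>M * Delta d b a * M\<close> is the outer product of column \<open>b\<close> and row
    \<open>a\<close>, which meet in the nonzero entry \<open>M $$ (a, b)\<close>.\<close>
  obtain c where c: "M * Delta d b a * M = c \<cdot>\<^sub>m M"
    using m by (fastforce simp: minimal_idem_def)
  have e: "M $$ (i, b) * M $$ (a, j) = c * M $$ (i, j)" if "i \<le> d" "j \<le> d" for i j
    using mult_Delta_mult_index[OF M M ab(2,1) that] that M by (simp add: c)
  \<comment> \<open>At position \<open>(a, b)\<close> the identity reads
    \<open>M $$ (a, b) * M $$ (a, b) = c * M $$ (a, b)\<close>.\<close>
  then have "c \<noteq> 0"
    using ab by force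
  then have "M $$ (i, j) = M $$ (i, b) * (M $$ (a, j) / c)" if "i \<le> d" "j \<le> d" for i j
    using e[OF that] by (simp add: field_simps)
  then show "vec_space.rank (Suc d) M = 1"
    unfolding rank_one_iff_outer_product[OF M]
    using \<open>M \<noteq> 0\<^sub>m (Suc d) (Suc d)\<close>
    by (intro conjI exI[of _ "\<lambda>i. M $$ (i, b)"] exI[of _ "\<lambda>j. M $$ (a, j) / c"])
      (simp_all add: less_Suc_eq_le)
next
  assume "vec_space.rank (Suc d) M = 1"
  then obtain u v where M0: "M \<noteq> 0\<^sub>m (Suc d) (Suc d)"
    and uv: "\<And>i j. i < Suc d \<Longrightarrow> j < Suc d \<Longrightarrow> M $$ (i, j) = u i * v j"
    unfolding rank_one_iff_outer_product[OF M] by auto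
  have "\<exists>c. M * X * M = c \<cdot>\<^sub>m M" if X: "X \<in> carrier_mat (Suc d) (Suc d)" for X
  proof -
    define c where "c = (\<Sum>l<Suc d. (\<Sum>m<Suc d. v m * X $$ (m, l)) * u l)"
    have MX: "(M * X) $$ (i, l) = u i * (\<Sum>m<Suc d. v m * X $$ (m, l))"
      if "i < Suc d" "l < Suc d" for i l
      using that by (subst mult_mat_index[OF M X that])
        (auto simp: uv sum_distrib_left mult.assoc simp del: sum.lessThan_Suc intro!: sum.cong)
    have "(M * X * M) $$ (i, j) = c * M $$ (i, j)" if "i < Suc d" "j < Suc d" for i j
    proof -
      have "(M * X * M) $$ (i, j) = (\<Sum>l<Suc d. (M * X) $$ (i, l) * M $$ (l, j))"
        using that by (intro mult_mat_index[OF mult_carrier_mat[OF M X] M]) auto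
      also have "\<dots> = c * M $$ (i, j)"
        unfolding c_def sum_distrib_right using that
        by (intro sum.cong refl) (simp add: MX uv sum_distrib_right sum_distrib_left ac_simps del: sum.lessThan_Suc)
      finally show ?thesis .
    qed
    then show ?thesis
      using M X by (intro exI[of _ c] eq_matI) auto
  qed
  then show "minimal_idem (Mat_alg d) M"
    using M MM M0 by (simp add: minimal_idem_def)
qed

section \<open>Systems of mutually orthogonal rank one idempotents\<close>

text \<open>Removes the \<open>SOME\<close> hidden in \<open>alg_rank\<close>: whichever isomorphism
  is chosen, it and its inverse both preserve minimal idempotents. The diagonal products are
  absorbed into \<open>minimal_idem\<close>.\<close>

lemma orth_rank1_idempotents_iff:
  assumes A: "is_algebra A" and iso: "alg_iso A (Mat_alg d) \<noteq> {}"
  shows "orth_rank1_idempotents d A E \<longleftrightarrow> (\<forall>i\<le>d. minimal_idem A (E i)) \<and>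
    (\<forall>i\<le>d. \<forall>j\<le>d. i \<noteq> j \<longrightarrow> E i \<otimes>\<^bsub>A\<^esub> E j = \<zero>\<^bsub>A\<^esub>)"
proof -
  define f where "f = (SOME f. f \<in> alg_iso A (Mat_alg d))"
  have f: "f \<in> alg_iso A (Mat_alg d)"
    using iso unfolding f_def by (metis equals0I someI)
  have *: "alg_rank d A e = 1 \<longleftrightarrow> minimal_idem A e"
    if e: "e \<in> carrier A" "e \<otimes>\<^bsub>A\<^esub> e = e" for e
  proof -
    have fe: "f e \<in> carrier_mat (Suc d) (Suc d)" "f e * f e = f e"
      using alg_isoD(1,2)[OF f] e by (force, metis module_mat_simps(1))
    have "inv_into (carrier A) f (f e) = e"
      using alg_isoD(4)[OF f] e by simp
    then have "minimal_idem (Mat_alg d) (f e) \<longleftrightarrow> minimal_idem A e"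
      using minimal_idem_alg_iso[OF A is_algebra_Mat_alg f]
        minimal_idem_alg_iso[OF is_algebra_Mat_alg A alg_iso_inv[OF A f], of "f e"] by auto
    then show ?thesis
      using minimal_idem_Mat_iff[OF fe] by (simp add: alg_rank_def f_def)
  qed
  show ?thesis
  proof
    assume "orth_rank1_idempotents d A E"
    then have c: "\<And>i. i \<le> d \<Longrightarrow> E i \<in> carrier A"
      and m: "\<And>i j. i \<le> d \<Longrightarrow> j \<le> d \<Longrightarrow> E i \<otimes>\<^bsub>A\<^esub> E j = (if i = j then E i else \<zero>\<^bsub>A\<^esub>)"
      and r: "\<And>i. i \<le> d \<Longrightarrow> alg_rank d A (E i) = 1"
      unfolding orth_rank1_idempotents_def by blast+
    have "minimal_idem A (E i)" if "i \<le> d" for i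
      using *[OF c[OF that]] m[OF that that] r[OF that] by simp
    then show "(\<forall>i\<le>d. minimal_idem A (E i)) \<and>
        (\<forall>i\<le>d. \<forall>j\<le>d. i \<noteq> j \<longrightarrow> E i \<otimes>\<^bsub>A\<^esub> E j = \<zero>\<^bsub>A\<^esub>)"
      using m by simp
  next
    assume o: "(\<forall>i\<le>d. minimal_idem A (E i)) \<and>
        (\<forall>i\<le>d. \<forall>j\<le>d. i \<noteq> j \<longrightarrow> E i \<otimes>\<^bsub>A\<^esub> E j = \<zero>\<^bsub>A\<^esub>)"
    then have m: "E i \<in> carrier A" "E i \<otimes>\<^bsub>A\<^esub> E i = E i" if "i \<le> d" for i
      using that unfolding minimal_idem_def by blast+
    have "alg_rank d A (E i) = 1" if "i \<le> d" for i
      using *[OF m[OF that]] o that by blast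
    then show "orth_rank1_idempotents d A E"
      using m o unfolding orth_rank1_idempotents_def by simp
  qed
qed

lemma orth_rank1_idempotents_Mat_iff_minimal:
  fixes E :: "nat \<Rightarrow> 'a::field mat"
  shows "orth_rank1_idempotents d (Mat_alg d) E \<longleftrightarrow> (\<forall>i\<le>d. minimal_idem (Mat_alg d) (E i)) \<and>
    (\<forall>i\<le>d. \<forall>j\<le>d. i \<noteq> j \<longrightarrow> E i * E j = 0\<^sub>m (Suc d) (Suc d))"
proof -
  have "(alg_iso (Mat_alg d) (Mat_alg d) :: ('a mat \<Rightarrow> 'a mat) set) \<noteq> {}"
    using alg_iso_id by blast
  from orth_rank1_idempotents_iff[OF is_algebra_Mat_alg this] show ?thesis
    by simp
qed

text \<open>The column vectors of the outer products become the columns of \<open>U\<close>, the row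
  vectors the rows of \<open>V\<close>. The relations between the \<open>E i\<close> then say
  \<open>V * U = 1\<^sub>m (Suc d)\<close>; as there are exactly \<open>d + 1\<close> idempotents,
  \<open>U\<close> and \<open>V\<close> are square and mutually inverse.\<close>

lemma orth_rank1_idempotents_Mat_iff:
  fixes E :: "nat \<Rightarrow> 'a::field mat"
  shows "orth_rank1_idempotents d (Mat_alg d) E \<longleftrightarrow>
    (\<exists>U V. U \<in> carrier_mat (Suc d) (Suc d) \<and> V \<in> carrier_mat (Suc d) (Suc d) \<and>
      U * V = 1\<^sub>m (Suc d) \<and> (\<forall>i\<le>d. E i = U * Delta d i i * V))"
proof
  assume "orth_rank1_idempotents d (Mat_alg d) E"
  then have Em: "\<And>i. i \<le> d \<Longrightarrow> minimal_idem (Mat_alg d) (E i)"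
    and orth: "\<And>i j. i \<le> d \<Longrightarrow> j \<le> d \<Longrightarrow> i \<noteq> j \<Longrightarrow> E i * E j = 0\<^sub>m (Suc d) (Suc d)"
    unfolding orth_rank1_idempotents_Mat_iff_minimal by blast+
  have Ec: "E i \<in> carrier_mat (Suc d) (Suc d)" and EE: "E i * E i = E i"
    and E0: "E i \<noteq> 0\<^sub>m (Suc d) (Suc d)" if "i \<le> d" for i
    using Em[OF that] by (auto simp: minimal_idem_def)
  have "\<exists>u v. \<forall>a<Suc d. \<forall>b<Suc d. E i $$ (a, b) = u a * v b" if i: "i \<le> d" for i
    using minimal_idem_Mat_iff[OF Ec[OF i] EE[OF i]] Em[OF i]
      rank_one_iff_outer_product[OF Ec[OF i]] by simp
  then obtain u v where
    uv: "\<And>i a b. i \<le> d \<Longrightarrow> a < Suc d \<Longrightarrow> b < Suc d \<Longrightarrow> E i $$ (a, b) = u i a * v i b"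
    by metis
  define U where "U = mat (Suc d) (Suc d) (\<lambda>(a, i). u i a)"
  define V where "V = mat (Suc d) (Suc d) (\<lambda>(i, b). v i b)"
  have U: "U \<in> carrier_mat (Suc d) (Suc d)" and V: "V \<in> carrier_mat (Suc d) (Suc d)"
    by (simp_all add: U_def V_def)
  have EUV: "E i = U * Delta d i i * V" if i: "i \<le> d" for i
  proof (rule eq_matI)
    fix a b
    assume "a < dim_row (U * Delta d i i * V)" "b < dim_col (U * Delta d i i * V)"
    then have "a \<le> d" "b \<le> d"
      using U V by auto
    then show "E i $$ (a, b) = (U * Delta d i i * V) $$ (a, b)"
      using i U V by (subst mult_Delta_mult_index) (auto simp: uv U_def V_def)
  qed (use Ec[OF i] U V in auto)
  have nz: "\<exists>a<Suc d. \<exists>b<Suc d. u i a \<noteq> 0 \<and> v i b \<noteq> 0" if i: "i \<le> d" for i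
  proof -
    have "\<exists>a<Suc d. \<exists>b<Suc d. E i $$ (a, b) \<noteq> 0"
      using E0[OF i] mat_neq_zero_iff[OF Ec[OF i]] by simp
    then show ?thesis
      using uv[OF i] by force
  qed
  \<comment> \<open>\<open>E i * E j\<close> is \<open>(V * U) $$ (i, j)\<close> times the outer
    product of \<open>u i\<close> and \<open>v j\<close>; comparing at a position where both vectors
    are nonzero isolates this scalar.\<close>
  have "(V * U) $$ (i, j) = 1\<^sub>m (Suc d) $$ (i, j)" if "i < Suc d" "j < Suc d" for i j
  proof -
    have ij: "i \<le> d" "j \<le> d" using that by auto
    obtain a where a: "a < Suc d" "u i a \<noteq> 0" using nz[OF ij(1)] by blast
    obtain b where b: "b < Suc d" "v j b \<noteq> 0" using nz[OF ij(2)] by blast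
    have VU: "(V * U) $$ (i, j) = (\<Sum>c<Suc d. v i c * u j c)"
      unfolding mult_mat_index[OF V U that]
      by (intro sum.cong) (use that in \<open>auto simp: U_def V_def\<close>)
    have "(E i * E j) $$ (a, b) = (\<Sum>c<Suc d. E i $$ (a, c) * E j $$ (c, b))"
      using a b by (intro mult_mat_index[OF Ec[OF ij(1)] Ec[OF ij(2)]])
    also have "\<dots> = u i a * (V * U) $$ (i, j) * v j b"
      unfolding VU sum_distrib_left sum_distrib_right
      by (intro sum.cong) (use ij a b in \<open>auto simp: uv\<close>)
    finally have e: "(E i * E j) $$ (a, b) = u i a * (V * U) $$ (i, j) * v j b" .
    show ?thesis
    proof (cases "i = j")
      case True
      then have "u i a * (V * U) $$ (i, j) * v j b = u i a * v j b"
        using e EE[OF ij(1)] uv[OF ij(1) a(1) b(1)] by simp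
      then show ?thesis using a b that True by simp
    next
      case False
      then show ?thesis using e orth[OF ij] a b that by simp
    qed
  qed
  then have "V * U = 1\<^sub>m (Suc d)"
    using U V by (intro eq_matI) auto
  then have "U * V = 1\<^sub>m (Suc d)"
    using mat_mult_left_right_inverse[OF V U] by simp
  then show "\<exists>U V. U \<in> carrier_mat (Suc d) (Suc d) \<and> V \<in> carrier_mat (Suc d) (Suc d) \<and>
      U * V = 1\<^sub>m (Suc d) \<and> (\<forall>i\<le>d. E i = U * Delta d i i * V)"
    using U V EUV by blast
next
  assume "\<exists>U V. U \<in> carrier_mat (Suc d) (Suc d) \<and> V \<in> carrier_mat (Suc d) (Suc d) \<and>
      U * V = 1\<^sub>m (Suc d) \<and> (\<forall>i\<le>d. E i = U * Delta d i i * V)"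
  then obtain U V where U: "U \<in> carrier_mat (Suc d) (Suc d)" and V: "V \<in> carrier_mat (Suc d) (Suc d)"
    and UV: "U * V = 1\<^sub>m (Suc d)" and E: "\<And>i. i \<le> d \<Longrightarrow> E i = U * Delta d i i * V"
    by blast
  have VU: "V * U = 1\<^sub>m (Suc d)"
    using U V UV by (rule mat_mult_left_right_inverse)
  have Ec: "E i \<in> carrier_mat (Suc d) (Suc d)" if "i \<le> d" for i
    using U V E[OF that] by auto
  have EE: "E i * E j = (if i = j then E i else 0\<^sub>m (Suc d) (Suc d))" if ij: "i \<le> d" "j \<le> d" for i j
  proof (rule eq_matI)
    fix a b
    assume "a < dim_row (if i = j then E i else 0\<^sub>m (Suc d) (Suc d))"
      "b < dim_col (if i = j then E i else 0\<^sub>m (Suc d) (Suc d))"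
    then have ab: "a < Suc d" "b < Suc d"
      using Ec[OF ij(1)] by (auto split: if_splits)
    have "(E i * E j) $$ (a, b) = (\<Sum>c<Suc d. E i $$ (a, c) * E j $$ (c, b))"
      using ab by (intro mult_mat_index[OF Ec[OF ij(1)] Ec[OF ij(2)]])
    also have "\<dots> = U $$ (a, i) * (\<Sum>c<Suc d. V $$ (i, c) * U $$ (c, j)) * V $$ (j, b)"
      unfolding sum_distrib_left sum_distrib_right
      by (intro sum.cong) (use ij ab U V in \<open>auto simp: E mult_Delta_mult_index simp del: assoc_mult_mat index_mult_mat(1)\<close>)
    also have "(\<Sum>c<Suc d. V $$ (i, c) * U $$ (c, j)) = (V * U) $$ (i, j)"
      using ij by (intro mult_mat_index[OF V U, symmetric]) auto
    finally show "(E i * E j) $$ (a, b) = (if i = j then E i else 0\<^sub>m (Suc d) (Suc d)) $$ (a, b)"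
      using ab ij U V by (auto simp: VU E mult_Delta_mult_index simp del: assoc_mult_mat index_mult_mat(1))
  qed (use Ec[OF ij(1)] Ec[OF ij(2)] in auto)
  have "minimal_idem (Mat_alg d) (E i)" if i: "i \<le> d" for i
  proof -
    have "E i \<noteq> 0\<^sub>m (Suc d) (Suc d)"
    proof
      assume 0: "E i = 0\<^sub>m (Suc d) (Suc d)"
      \<comment> \<open>Conjugating back recovers \<open>Delta d i i\<close>, whose diagonal entry 1
        excludes \<open>E i\<close> being zero.\<close>
      have "V * (E i) * U = V * U * Delta d i i * (V * U)"
        using U V E[OF i]
        by (simp add: assoc_mult_mat[of _ "Suc d" "Suc d" _ "Suc d" _ "Suc d"]
          mult_carrier_mat[of _ "Suc d" "Suc d" _ "Suc d"])
      also have "\<dots> = Delta d i i"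
        unfolding VU by (simp add: left_mult_one_mat[OF Delta_carrier] right_mult_one_mat[OF Delta_carrier])
      finally have "Delta d i i = (0\<^sub>m (Suc d) (Suc d) :: 'a mat)"
        using 0 U V by simp
      then have "Delta d i i $$ (i, i) = (0 :: 'a)"
        using i by simp
      then show False using i by simp
    qed
    moreover have "\<forall>a<Suc d. \<forall>b<Suc d. E i $$ (a, b) = U $$ (a, i) * V $$ (i, b)"
      using i U V E[OF i] by (auto simp: mult_Delta_mult_index simp del: assoc_mult_mat index_mult_mat(1))
    ultimately have "vec_space.rank (Suc d) (E i) = 1"
      unfolding rank_one_iff_outer_product[OF Ec[OF i]]
      by (intro conjI exI[of _ "\<lambda>a. U $$ (a, i)"] exI[of _ "\<lambda>b. V $$ (i, b)"]) auto
    then show ?thesis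
      using minimal_idem_Mat_iff[OF Ec[OF i]] EE[OF i i] by simp
  qed
  then show "orth_rank1_idempotents d (Mat_alg d) E"
    unfolding orth_rank1_idempotents_Mat_iff_minimal using EE by simp
qed

section \<open>The systems \<open>Phi d R\<close> and transport along isomorphisms\<close>

text \<open>Let \<open>S\<close> be the inverse of \<open>R\<close>. The first triple product has
  \<open>R $$ (0, i) * S $$ (i, 0)\<close> as its only possibly nonzero entry, which tests row 0 of
  \<open>R\<close> and column 0 of \<open>S\<close>. The second is
  \<open>S $$ (0, i) * R $$ (i, 0)\<close> times the outer product of column 0 of \<open>R\<close>
  and row 0 of \<open>S\<close>, which tests the other two.\<close>

lemma idempotent_system_Phi_iff:
  fixes R :: "'a::field mat"
  assumes "R \<in> Units (Mat_alg d)"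
  shows "idempotent_system d (Phi d R) \<longleftrightarrow> solid_invertible d R"
proof -
  define S where "S = Mat_inv d R"
  let ?D = "\<lambda>i. R * Delta d i i * S"
  note R = Mat_inv_props(1,2,3)[OF assms, folded S_def]
  have D: "?D i \<in> carrier_mat (Suc d) (Suc d)" for i
    using R by (intro mult_carrier_mat[of _ _ "Suc d"]) auto
  have o: "orth_rank1_idempotents d (Mat_alg d) (\<lambda>i. Delta d i i :: 'a mat)"
    unfolding orth_rank1_idempotents_Mat_iff
    by (intro exI[of _ "1\<^sub>m (Suc d)"])
      (simp add: left_mult_one_mat[OF Delta_carrier] right_mult_one_mat[OF Delta_carrier])
  have o': "orth_rank1_idempotents d (Mat_alg d) ?D"
    unfolding orth_rank1_idempotents_Mat_iff using R by blast
  have ne: "(alg_iso (Mat_alg d) (Mat_alg d) :: ('a mat \<Rightarrow> 'a mat) set) \<noteq> {}"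
    using alg_iso_id by blast
  have 1: "Delta d 0 0 * ?D i * Delta d 0 0 \<noteq> 0\<^sub>m (Suc d) (Suc d) \<longleftrightarrow>
      R $$ (0, i) \<noteq> 0 \<and> S $$ (i, 0) \<noteq> 0" (is "?M \<noteq> _ \<longleftrightarrow> _") if i: "i \<le> d" for i
  proof -
    have e: "?M $$ (a, b) = (if a = 0 \<and> b = 0 then R $$ (0, i) * S $$ (i, 0) else 0)"
      if "a \<le> d" "b \<le> d" for a b
      using that i by (simp add: Delta_mult_Delta_index[OF D] mult_Delta_mult_index[OF R(1,2)]
        del: assoc_mult_mat index_mult_mat(1))
    have c: "?M \<in> carrier_mat (Suc d) (Suc d)"
      by (intro mult_carrier_mat[OF mult_carrier_mat[OF Delta_carrier D] Delta_carrier])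
    have "?M \<noteq> 0\<^sub>m (Suc d) (Suc d) \<longleftrightarrow> (\<exists>a\<le>d. \<exists>b\<le>d. ?M $$ (a, b) \<noteq> 0)"
      unfolding mat_neq_zero_iff[OF c] less_Suc_eq_le ..
    also have "\<dots> \<longleftrightarrow> (\<exists>a\<le>d. \<exists>b\<le>d. a = 0 \<and> b = 0 \<and> R $$ (0, i) * S $$ (i, 0) \<noteq> 0)"
      by (intro ex_cong1 conj_cong refl) (simp add: e del: assoc_mult_mat index_mult_mat(1))
    finally show ?thesis by auto
  qed
  have 2: "?D 0 * Delta d i i * ?D 0 \<noteq> 0\<^sub>m (Suc d) (Suc d) \<longleftrightarrow>
      (\<exists>a\<le>d. \<exists>b\<le>d. R $$ (a, 0) * S $$ (0, i) * (R $$ (i, 0) * S $$ (0, b)) \<noteq> 0)"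
      (is "?M \<noteq> _ \<longleftrightarrow> _") if i: "i \<le> d" for i
  proof -
    have e: "?M $$ (a, b) = R $$ (a, 0) * S $$ (0, i) * (R $$ (i, 0) * S $$ (0, b))"
      if "a \<le> d" "b \<le> d" for a b
      using that i by (simp add: mult_Delta_mult_index[OF D D] mult_Delta_mult_index[OF R(1,2)]
        del: assoc_mult_mat index_mult_mat(1))
    have c: "?M \<in> carrier_mat (Suc d) (Suc d)"
      by (intro mult_carrier_mat[OF mult_carrier_mat[OF D Delta_carrier] D])
    have "?M \<noteq> 0\<^sub>m (Suc d) (Suc d) \<longleftrightarrow> (\<exists>a\<le>d. \<exists>b\<le>d. ?M $$ (a, b) \<noteq> 0)"
      unfolding mat_neq_zero_iff[OF c] less_Suc_eq_le ..
    also have "\<dots> \<longleftrightarrow> (\<exists>a\<le>d. \<exists>b\<le>d. R $$ (a, 0) * S $$ (0, i) * (R $$ (i, 0) * S $$ (0, b)) \<noteq> 0)"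
      by (intro ex_cong1 conj_cong refl) (simp add: e del: assoc_mult_mat index_mult_mat(1))
    finally show ?thesis .
  qed
  have "idempotent_system d (Phi d R) \<longleftrightarrow>
    (\<forall>i\<le>d. Delta d 0 0 * ?D i * Delta d 0 0 \<noteq> 0\<^sub>m (Suc d) (Suc d)) \<and>
    (\<forall>i\<le>d. ?D 0 * Delta d i i * ?D 0 \<noteq> 0\<^sub>m (Suc d) (Suc d))"
    using o o' ne is_algebra_Mat_alg[where 'a = 'a] unfolding idempotent_system_def Phi_def Let_def S_def[symmetric]
    by (simp del: assoc_mult_mat index_mult_mat(1))
  also have "\<dots> \<longleftrightarrow> (\<forall>i\<le>d. R $$ (0, i) \<noteq> 0 \<and> S $$ (i, 0) \<noteq> 0) \<and>
    (\<forall>i\<le>d. \<exists>a\<le>d. \<exists>b\<le>d. R $$ (a, 0) * S $$ (0, i) * (R $$ (i, 0) * S $$ (0, b)) \<noteq> 0)"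
    using 1 2 by presburger
  \<comment> \<open>Nonvanishing for some \<open>a\<close>, \<open>b\<close> already gives the
    factors indexed by \<open>i\<close>; conversely, for solid \<open>R\<close> any \<open>a\<close>
    and \<open>b\<close> are witnesses.\<close>
  also have "\<dots> \<longleftrightarrow> solid_invertible d R"
    unfolding solid_invertible_def S_def[symmetric] using assms by (fastforce simp del: assoc_mult_mat index_mult_mat(1))
  finally show ?thesis .
qed

text \<open>The three carrier types may differ, whereas \<open>idem_iso_rel\<close> relates systems
  over one carrier type. This allows a system on an arbitrary carrier to be compared with matrix
  systems.\<close>

lemma idem_isomorphic_trans:
  assumes "idem_isomorphic d \<Phi> \<Psi>" "idem_isomorphic d \<Psi> \<Omega>"
  shows "idem_isomorphic d \<Phi> \<Omega>"
proof -
  obtain f where f: "f \<in> alg_iso (ambient \<Phi>) (ambient \<Psi>)"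
    "\<forall>i\<le>d. f (idem \<Phi> i) = idem \<Psi> i \<and> f (dual_idem \<Phi> i) = dual_idem \<Psi> i"
    using assms(1) by (auto simp: idem_isomorphic_def)
  obtain g where g: "g \<in> alg_iso (ambient \<Psi>) (ambient \<Omega>)"
    "\<forall>i\<le>d. g (idem \<Psi> i) = idem \<Omega> i \<and> g (dual_idem \<Psi> i) = dual_idem \<Omega> i"
    using assms(2) by (auto simp: idem_isomorphic_def)
  show ?thesis
    unfolding idem_isomorphic_def using alg_iso_comp[OF f(1) g(1)] f(2) g(2)
    by (intro bexI[of _ "g \<circ> f"]) auto
qed

lemma idempotent_system_carrier:
  assumes "idempotent_system d \<Phi>"
  shows "is_algebra (ambient \<Phi>)"
    and "i \<le> d \<Longrightarrow> idem \<Phi> i \<in> carrier (ambient \<Phi>)"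
    and "i \<le> d \<Longrightarrow> dual_idem \<Phi> i \<in> carrier (ambient \<Phi>)"
  using assms by (auto simp: idempotent_system_def orth_rank1_idempotents_def Let_def)

text \<open>\<open>inv_into\<close> undoes the isomorphism only on the carrier; the assumption on
  \<open>\<Phi>\<close> places the idempotents of index at most \<open>d\<close> there.\<close>

lemma idem_isomorphic_sym:
  assumes \<Phi>: "idempotent_system d \<Phi>" and iso: "idem_isomorphic d \<Phi> \<Psi>"
  shows "idem_isomorphic d \<Psi> \<Phi>"
proof -
  note c = idempotent_system_carrier[OF \<Phi>]
  obtain f where f: "f \<in> alg_iso (ambient \<Phi>) (ambient \<Psi>)"
    "\<forall>i\<le>d. f (idem \<Phi> i) = idem \<Psi> i \<and> f (dual_idem \<Phi> i) = dual_idem \<Psi> i"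
    using iso by (auto simp: idem_isomorphic_def)
  have "inv_into (carrier (ambient \<Phi>)) f (idem \<Psi> i) = idem \<Phi> i \<and>
      inv_into (carrier (ambient \<Phi>)) f (dual_idem \<Psi> i) = dual_idem \<Phi> i" if "i \<le> d" for i
    using inv_into_f_f[OF alg_isoD(4)[OF f(1)]] c(2,3) f(2) that by metis
  then show ?thesis
    unfolding idem_isomorphic_def using alg_iso_inv[OF c(1) f(1)] by blast
qed

text \<open>Minimality, products and zero are all preserved by the isomorphism. Membership in
  \<open>alg_iso\<close> does not by itself make the target an algebra, hence the last
  assumption.\<close>

lemma idempotent_system_isomorphic:
  assumes \<Phi>: "idempotent_system d \<Phi>" and iso: "idem_isomorphic d \<Phi> \<Psi>"
    and B: "is_algebra (ambient \<Psi>)"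
  shows "idempotent_system d \<Psi>"
proof -
  let ?A = "ambient \<Phi>" and ?B = "ambient \<Psi>"
  have A: "is_algebra ?A" and Am: "alg_iso ?A (Mat_alg d) \<noteq> {}"
    and o: "orth_rank1_idempotents d ?A (idem \<Phi>)" "orth_rank1_idempotents d ?A (dual_idem \<Phi>)"
    and 1: "\<And>i. i \<le> d \<Longrightarrow> idem \<Phi> 0 \<otimes>\<^bsub>?A\<^esub> dual_idem \<Phi> i \<otimes>\<^bsub>?A\<^esub> idem \<Phi> 0 \<noteq> \<zero>\<^bsub>?A\<^esub>"
    and 2: "\<And>i. i \<le> d \<Longrightarrow> dual_idem \<Phi> 0 \<otimes>\<^bsub>?A\<^esub> idem \<Phi> i \<otimes>\<^bsub>?A\<^esub> dual_idem \<Phi> 0 \<noteq> \<zero>\<^bsub>?A\<^esub>"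
    using \<Phi> unfolding idempotent_system_def Let_def by blast+
  interpret A: assoc_algebra class_ring ?A by fact
  obtain f where f: "f \<in> alg_iso ?A ?B"
    and fi: "\<And>i. i \<le> d \<Longrightarrow> f (idem \<Phi> i) = idem \<Psi> i"
    and fd: "\<And>i. i \<le> d \<Longrightarrow> f (dual_idem \<Phi> i) = dual_idem \<Psi> i"
    using iso unfolding idem_isomorphic_def by blast
  note h = alg_isoD[OF f]
  have Bm: "alg_iso ?B (Mat_alg d) \<noteq> {}"
    using Am alg_iso_comp[OF alg_iso_inv[OF A f]] by blast
  have f0: "f x = \<zero>\<^bsub>?B\<^esub> \<longleftrightarrow> x = \<zero>\<^bsub>?A\<^esub>" if "x \<in> carrier ?A" for x
    using inj_onD[OF h(4) _ that A.zero_closed] alg_iso_zero[OF A B f] by auto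
  note c = idempotent_system_carrier(2,3)[OF \<Phi>]
  have transport: "orth_rank1_idempotents d ?B E'"
    if E: "orth_rank1_idempotents d ?A E" and fE: "\<And>i. i \<le> d \<Longrightarrow> f (E i) = E' i" for E E'
  proof -
    have m: "minimal_idem ?A (E i)" if "i \<le> d" for i
      using E that unfolding orth_rank1_idempotents_iff[OF A Am] by blast
    have e: "E i \<otimes>\<^bsub>?A\<^esub> E j = \<zero>\<^bsub>?A\<^esub>" if "i \<le> d" "j \<le> d" "i \<noteq> j" for i j
      using E that unfolding orth_rank1_idempotents_iff[OF A Am] by blast
    have "minimal_idem ?B (E' i)" if "i \<le> d" for i
      using minimal_idem_alg_iso[OF A B f m[OF that]] fE[OF that] by simp
    moreover have "E' i \<otimes>\<^bsub>?B\<^esub> E' j = \<zero>\<^bsub>?B\<^esub>" if ij: "i \<le> d" "j \<le> d" "i \<noteq> j" for i j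
    proof -
      have "E i \<in> carrier ?A" "E j \<in> carrier ?A"
        using m[OF ij(1)] m[OF ij(2)] by (auto simp: minimal_idem_def)
      then have "f (E i \<otimes>\<^bsub>?A\<^esub> E j) = E' i \<otimes>\<^bsub>?B\<^esub> E' j"
        using h(2) fE ij by metis
      then show ?thesis
        using e[OF ij] alg_iso_zero[OF A B f] by simp
    qed
    ultimately show ?thesis
      unfolding orth_rank1_idempotents_iff[OF B Bm] by blast
  qed
  have "idem \<Psi> 0 \<otimes>\<^bsub>?B\<^esub> dual_idem \<Psi> i \<otimes>\<^bsub>?B\<^esub> idem \<Psi> 0 \<noteq> \<zero>\<^bsub>?B\<^esub>" if i: "i \<le> d" for i
  proof -
    have "f (idem \<Phi> 0 \<otimes>\<^bsub>?A\<^esub> dual_idem \<Phi> i \<otimes>\<^bsub>?A\<^esub> idem \<Phi> 0) =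
        idem \<Psi> 0 \<otimes>\<^bsub>?B\<^esub> dual_idem \<Psi> i \<otimes>\<^bsub>?B\<^esub> idem \<Psi> 0"
      using h(2) fi[of 0] fd[OF i] c(1)[of 0] c(2)[OF i] A.m_closed by simp
    then show ?thesis
      using f0 1[OF i] c(1)[of 0] c(2)[OF i] A.m_closed by (metis le0)
  qed
  moreover have "dual_idem \<Psi> 0 \<otimes>\<^bsub>?B\<^esub> idem \<Psi> i \<otimes>\<^bsub>?B\<^esub> dual_idem \<Psi> 0 \<noteq> \<zero>\<^bsub>?B\<^esub>" if i: "i \<le> d" for i
  proof -
    have "f (dual_idem \<Phi> 0 \<otimes>\<^bsub>?A\<^esub> idem \<Phi> i \<otimes>\<^bsub>?A\<^esub> dual_idem \<Phi> 0) =
        dual_idem \<Psi> 0 \<otimes>\<^bsub>?B\<^esub> idem \<Psi> i \<otimes>\<^bsub>?B\<^esub> dual_idem \<Psi> 0"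
      using h(2) fd[of 0] fi[OF i] c(2)[of 0] c(1)[OF i] A.m_closed by simp
    then show ?thesis
      using f0 2[OF i] c(2)[of 0] c(1)[OF i] A.m_closed by (metis le0)
  qed
  ultimately show ?thesis
    using B Bm transport[OF o(1) fi] transport[OF o(2) fd]
    unfolding idempotent_system_def Let_def by blast
qed

section \<open>Reduction to \<open>Phi d R\<close> with \<open>R\<close> normalized\<close>

text \<open>After passing to matrices, \<open>U\<close> diagonalizes the first sequence and
  \<open>X\<close> the dual one. Conjugation by \<open>V\<close>, the inverse of \<open>U\<close>,
  makes the first sequence diagonal and leaves \<open>W = V * X\<close>, the transition matrix
  between the two bases; its solidity follows because \<open>Phi d W\<close> inherits being an
  idempotent system.\<close>

lemma idempotent_system_isomorphic_Phi:
  fixes \<Phi> :: "('a::field, 'b) idem_pair"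
  assumes \<Phi>: "idempotent_system d \<Phi>"
  obtains W where "solid_invertible d W" "idem_isomorphic d \<Phi> (Phi d W)"
proof -
  have A: "is_algebra (ambient \<Phi>)" and "alg_iso (ambient \<Phi>) (Mat_alg d) \<noteq> {}"
    using \<Phi> unfolding idempotent_system_def Let_def by blast+
  then obtain f where f: "f \<in> alg_iso (ambient \<Phi>) (Mat_alg d)"
    by blast
  define \<Psi> where "\<Psi> = \<lparr>ambient = (Mat_alg d :: ('a, 'a mat) module),
    idem = (\<lambda>i. f (idem \<Phi> i)), dual_idem = (\<lambda>i. f (dual_idem \<Phi> i))\<rparr>"
  have iso: "idem_isomorphic d \<Phi> \<Psi>"
    unfolding idem_isomorphic_def \<Psi>_def using f by auto
  have "idempotent_system d \<Psi>"
    using idempotent_system_isomorphic[OF \<Phi> iso] is_algebra_Mat_alg[where 'a = 'a] by (simp add: \<Psi>_def)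
  then have "orth_rank1_idempotents d (Mat_alg d) (idem \<Psi>)"
    and "orth_rank1_idempotents d (Mat_alg d) (dual_idem \<Psi>)"
    unfolding idempotent_system_def Let_def by (simp_all add: \<Psi>_def)
  then obtain U V X Y where
    c: "U \<in> carrier_mat (Suc d) (Suc d)" "V \<in> carrier_mat (Suc d) (Suc d)"
      "X \<in> carrier_mat (Suc d) (Suc d)" "Y \<in> carrier_mat (Suc d) (Suc d)"
    and UV: "U * V = 1\<^sub>m (Suc d)" and XY: "X * Y = 1\<^sub>m (Suc d)"
    and E: "\<And>i. i \<le> d \<Longrightarrow> idem \<Psi> i = U * Delta d i i * V"
    and E': "\<And>i. i \<le> d \<Longrightarrow> dual_idem \<Psi> i = X * Delta d i i * Y"
    unfolding orth_rank1_idempotents_Mat_iff by metis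
  note as = assoc_mult_mat[of _ "Suc d" "Suc d" _ "Suc d" _ "Suc d"]
  note cl = mult_carrier_mat[of _ "Suc d" "Suc d" _ "Suc d"]
  have VU: "V * U = 1\<^sub>m (Suc d)"
    using mat_mult_left_right_inverse[OF c(1,2) UV] .
  have canc: "X * (Y * Z) = Z" "V * (U * Z) = Z" if "Z \<in> carrier_mat (Suc d) (Suc d)" for Z
    using that c as[of X Y Z] as[of V U Z] XY VU by simp_all
  have "V * X * (Y * U) = 1\<^sub>m (Suc d)"
    using c canc VU by (simp add: as cl)
  note inv = Mat_inv_eqI[OF cl[OF c(2,3)] cl[OF c(4,1)] this]
  have "idem_isomorphic d \<Psi> (Phi d (V * X))"
    unfolding idem_isomorphic_def
  proof (intro bexI[of _ "\<lambda>z. V * z * U"] allI impI conjI)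
    fix i assume i: "i \<le> d"
    show "V * idem \<Psi> i * U = idem (Phi d (V * X)) i"
      using c canc VU by (simp add: E[OF i] Phi_def as cl right_mult_one_mat[OF Delta_carrier])
    show "V * dual_idem \<Psi> i * U = dual_idem (Phi d (V * X)) i"
      using c unfolding E'[OF i] Phi_def inv(2) by (simp add: as cl)
  qed (use alg_iso_conj[OF c(2,1) VU] in \<open>simp add: \<Psi>_def Phi_def\<close>)
  then have "idem_isomorphic d \<Phi> (Phi d (V * X))"
    using idem_isomorphic_trans[OF iso] by blast
  moreover from this have "idempotent_system d (Phi d (V * X))"
    by (rule idempotent_system_isomorphic[OF \<Phi>]) (simp only: Phi_def idem_pair.simps is_algebra_Mat_alg)
  ultimately show ?thesis
    using that idempotent_system_Phi_iff[OF inv(1)] by blast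
qed

lemma diag_mult_diag_index:
  fixes x :: "'a::field mat"
  assumes x: "x \<in> carrier_mat n n" and ij: "i < n" "j < n"
  shows "(mat n n (\<lambda>(a, b). if a = b then p a else 0) * x *
    mat n n (\<lambda>(a, b). if a = b then q a else 0)) $$ (i, j) = p i * x $$ (i, j) * q j"
proof -
  let ?P = "mat n n (\<lambda>(a, b). if a = b then p a else 0)"
  let ?Q = "mat n n (\<lambda>(a, b). if a = b then q a else 0)"
  have P: "(?P * x) $$ (i, l) = p i * x $$ (i, l)" if "l < n" for l
  proof -
    have "(?P * x) $$ (i, l) = (\<Sum>m<n. ?P $$ (i, m) * x $$ (m, l))"
      using that ij x by (intro mult_mat_index) auto
    also have "\<dots> = (\<Sum>m<n. if m = i then p i * x $$ (i, l) else 0)"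
      using ij by (intro sum.cong) auto
    finally show ?thesis using ij by simp
  qed
  have "(?P * x * ?Q) $$ (i, j) = (\<Sum>m<n. (?P * x) $$ (i, m) * ?Q $$ (m, j))"
    using ij x by (intro mult_mat_index mult_carrier_mat) auto
  also have "\<dots> = (\<Sum>m<n. if m = j then p i * x $$ (i, j) * q j else 0)"
    using ij P by (intro sum.cong) auto
  finally show ?thesis using ij by simp
qed

text \<open>Dividing row \<open>i\<close> by \<open>W $$ (i, 0)\<close> makes column 0 constantly 1.
  Scaling column \<open>j\<close> by \<open>s j\<close> divides row \<open>j\<close> of the inverse
  by \<open>s j\<close>, and \<open>s\<close> is chosen so that column 0 of the inverse becomes
  constantly \<open>V $$ (0, 0) * W $$ (0, 0)\<close>.\<close>

lemma solid_invertible_normalize: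
  fixes W :: "'a::field mat"
  assumes W: "solid_invertible d W"
  obtains R where "R \<in> normalized_solid_invertible d" "idem_isomorphic d (Phi d W) (Phi d R)"
proof -
  let ?n = "Suc d"
  have Wu: "W \<in> Units (Mat_alg d)"
    using W by (simp add: solid_invertible_def)
  define V where "V = Mat_inv d W"
  note Wc = Mat_inv_props(1)[OF Wu] and Vc = Mat_inv_props(2)[OF Wu, folded V_def]
    and WV = Mat_inv_props(3)[OF Wu, folded V_def]
  have nz: "W $$ (i, 0) \<noteq> 0" "W $$ (0, i) \<noteq> 0" "V $$ (i, 0) \<noteq> 0" "V $$ (0, i) \<noteq> 0"
    if "i \<le> d" for i
    using W that by (auto simp: solid_invertible_def V_def)
  \<comment> \<open>Dividing by \<open>V $$ (0, 0)\<close> gives \<open>s 0 = 1\<close>, so column 0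
    of \<open>R\<close> stays untouched by the column scaling.\<close>
  define s where "s i = V $$ (i, 0) / V $$ (0, 0)" for i
  have s: "s i \<noteq> 0" "s 0 = 1" if "i \<le> d" for i
    using nz[OF that] nz[of 0] by (auto simp: s_def)
  define R where "R = mat ?n ?n (\<lambda>(i, j). W $$ (i, j) * s j / W $$ (i, 0))"
  define S where "S = mat ?n ?n (\<lambda>(i, j). V $$ (i, j) * W $$ (j, 0) / s i)"
  have Rc: "R \<in> carrier_mat ?n ?n" and Sc: "S \<in> carrier_mat ?n ?n"
    by (simp_all add: R_def S_def)
  have R: "R $$ (i, j) = W $$ (i, j) * s j / W $$ (i, 0)"
    and S: "S $$ (i, j) = V $$ (i, j) * W $$ (j, 0) / s i" if "i \<le> d" "j \<le> d" for i j
    using that by (simp_all add: R_def S_def)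
  have "(R * S) $$ (i, j) = 1\<^sub>m ?n $$ (i, j)" if ij: "i < ?n" "j < ?n" for i j
  proof -
    have "(R * S) $$ (i, j) = (\<Sum>l<?n. R $$ (i, l) * S $$ (l, j))"
      by (rule mult_mat_index[OF Rc Sc ij])
    \<comment> \<open>The factors \<open>s l\<close> cancel. The remaining quotient is 1 on the
      diagonal, while off the diagonal \<open>W * V\<close> vanishes.\<close>
    also have "\<dots> = (\<Sum>l<?n. W $$ (i, l) * V $$ (l, j)) * (W $$ (j, 0) / W $$ (i, 0))"
      unfolding sum_distrib_right using ij s
      by (intro sum.cong) (auto simp: R S less_Suc_eq_le)
    also have "(\<Sum>l<?n. W $$ (i, l) * V $$ (l, j)) = (W * V) $$ (i, j)"
      by (rule mult_mat_index[OF Wc Vc ij, symmetric])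
    finally show ?thesis
      using ij nz(1)[of i] WV by auto
  qed
  then have "R * S = 1\<^sub>m ?n"
    using Rc Sc by (intro eq_matI) auto
  note inv = Mat_inv_eqI[OF Rc Sc this]
  have "R \<in> normalized_solid_invertible d"
    using inv(1) nz s nz[of 0] unfolding normalized_solid_invertible_def mem_Collect_eq solid_invertible_def inv(2)
    by (auto simp: R S s_def)
  moreover have "idem_isomorphic d (Phi d W) (Phi d R)"
  proof -
    define P where "P = mat ?n ?n (\<lambda>(a, b). if a = b then inverse (W $$ (a, 0)) else 0)"
    define Q where "Q = mat ?n ?n (\<lambda>(a, b). if a = b then W $$ (a, 0) else 0)"
    have Pc: "P \<in> carrier_mat ?n ?n" and Qc: "Q \<in> carrier_mat ?n ?n"
      by (simp_all add: P_def Q_def)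
    have PxQ: "(P * x * Q) $$ (i, j) = inverse (W $$ (i, 0)) * x $$ (i, j) * W $$ (j, 0)"
      if "x \<in> carrier_mat ?n ?n" "i \<le> d" "j \<le> d" for x i j
      using diag_mult_diag_index[OF that(1), of i j "\<lambda>a. inverse (W $$ (a, 0))" "\<lambda>a. W $$ (a, 0)"]
        that by (simp add: P_def Q_def)
    have PQ: "P * Q = 1\<^sub>m ?n"
    proof (rule eq_matI)
      fix i j
      assume "i < dim_row (1\<^sub>m ?n :: 'a mat)" "j < dim_col (1\<^sub>m ?n :: 'a mat)"
      then have ij: "i \<le> d" "j \<le> d" by auto
      show "(P * Q) $$ (i, j) = 1\<^sub>m ?n $$ (i, j)"
        using PxQ[OF one_carrier_mat ij, unfolded right_mult_one_mat[OF Pc]] ij nz by auto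
    qed (use Pc Qc in auto)
    show ?thesis
      unfolding idem_isomorphic_def
    proof (intro bexI[of _ "\<lambda>x. P * x * Q"] allI impI conjI)
      fix i assume i: "i \<le> d"
      show "P * idem (Phi d W) i * Q = idem (Phi d R) i"
        by (rule eq_matI)
          (use Pc Qc nz in \<open>auto simp: Phi_def PxQ less_Suc_eq_le Delta_def simp del: index_mult_mat(1)\<close>)
      have c: "W * Delta d i i * V \<in> carrier_mat ?n ?n" "R * Delta d i i * S \<in> carrier_mat ?n ?n"
        using Wc Vc Rc Sc by (auto intro!: mult_carrier_mat[of _ _ "Suc d"])
      \<comment> \<open>Conjugation accounts for the row scaling; the column factor
        \<open>s i\<close> cancels between column \<open>i\<close> of \<open>R\<close> and row
        \<open>i\<close> of \<open>S\<close>.\<close>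
      have "P * (W * Delta d i i * V) * Q = R * Delta d i i * S"
      proof (rule eq_matI)
        fix a b
        assume "a < dim_row (R * Delta d i i * S)" "b < dim_col (R * Delta d i i * S)"
        then have ab: "a \<le> d" "b \<le> d"
          using c by auto
        show "(P * (W * Delta d i i * V) * Q) $$ (a, b) = (R * Delta d i i * S) $$ (a, b)"
          unfolding PxQ[OF c(1) ab] mult_Delta_mult_index[OF Wc Vc i i ab]
            mult_Delta_mult_index[OF Rc Sc i i ab]
          using i ab s by (simp add: R S field_simps)
      qed (use Pc Qc Rc Sc in auto)
      then show "P * dual_idem (Phi d W) i * Q = dual_idem (Phi d R) i"
        unfolding Phi_def inv(2) V_def by simp
    qed (use alg_iso_conj[OF Pc Qc PQ] in \<open>simp add: Phi_def\<close>)
  qed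
  ultimately show ?thesis
    using that by blast
qed

section \<open>Uniqueness of the normalized matrix\<close>

text \<open>An automorphism fixing all \<open>\<Delta>\<^sub>i\<^sub>i\<close> multiplies each matrix entry by a constant, since
  \<open>\<Delta>\<^sub>i\<^sub>i x \<Delta>\<^sub>j\<^sub>j\<close> is a multiple of \<open>\<Delta>\<^sub>i\<^sub>j\<close>.\<close>

lemma alg_iso_fix_Delta:
  fixes f :: "'a::field mat \<Rightarrow> 'a mat"
  assumes f: "f \<in> alg_iso (Mat_alg d) (Mat_alg d)"
    and fix_Delta: "\<And>i. i \<le> d \<Longrightarrow> f (Delta d i i) = Delta d i i"
    and x: "x \<in> carrier_mat (Suc d) (Suc d)" and ij: "i \<le> d" "j \<le> d"
  shows "f x $$ (i, j) = x $$ (i, j) * f (Delta d i j) $$ (i, j)"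
proof -
  note h = alg_isoD[OF f, simplified]
  have c: "Delta d i i * x \<in> carrier_mat (Suc d) (Suc d)"
    using x by (intro mult_carrier_mat[of _ _ "Suc d"]) auto
  have fx: "f x \<in> carrier_mat (Suc d) (Suc d)"
    using h(1)[OF x] .
  have fD: "f (Delta d i j) \<in> carrier_mat (Suc d) (Suc d)"
    using h(1) by simp
  have "Delta d i i * x * Delta d j j = x $$ (i, j) \<cdot>\<^sub>m Delta d i j"
  proof (rule eq_matI)
    fix a b
    assume "a < dim_row (x $$ (i, j) \<cdot>\<^sub>m Delta d i j)" "b < dim_col (x $$ (i, j) \<cdot>\<^sub>m Delta d i j)"
    then have ab: "a \<le> d" "b \<le> d"
      by (auto simp: Delta_def)
    show "(Delta d i i * x * Delta d j j) $$ (a, b) = (x $$ (i, j) \<cdot>\<^sub>m Delta d i j) $$ (a, b)"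
      using Delta_mult_Delta_index[OF x ij ab ij] ab by (simp add: Delta_def)
  qed (use x in \<open>auto simp: Delta_def\<close>)
  then have "f (Delta d i i * x * Delta d j j) = x $$ (i, j) \<cdot>\<^sub>m f (Delta d i j)"
    using h(3) by simp
  moreover have "f (Delta d i i * x * Delta d j j) = Delta d i i * f x * Delta d j j"
    unfolding h(2)[OF c Delta_carrier] h(2)[OF Delta_carrier x] fix_Delta[OF ij(1)] fix_Delta[OF ij(2)] ..
  ultimately have "(Delta d i i * f x * Delta d j j) $$ (i, j) = (x $$ (i, j) \<cdot>\<^sub>m f (Delta d i j)) $$ (i, j)"
    by simp
  then show ?thesis
    using Delta_mult_Delta_index[OF fx ij ij ij] fD ij by simp
qed

lemma normalized_Phi_isomorphic_eq:
  fixes R S :: "'a::field mat"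
  assumes R: "R \<in> normalized_solid_invertible d" and S: "S \<in> normalized_solid_invertible d"
    and iso: "idem_isomorphic d (Phi d R) (Phi d S)"
  shows "R = S"
proof -
  obtain f where f: "f \<in> alg_iso (Mat_alg d) (Mat_alg d)"
    and fix_Delta: "\<And>i. i \<le> d \<Longrightarrow> f (Delta d i i) = Delta d i i"
    and fd: "\<And>i. i \<le> d \<Longrightarrow> f (R * Delta d i i * Mat_inv d R) = S * Delta d i i * Mat_inv d S"
    using iso by (auto simp: idem_isomorphic_def Phi_def)
  have Ru: "R \<in> Units (Mat_alg d)" and Su: "S \<in> Units (Mat_alg d)"
    using R S by (auto simp: normalized_solid_invertible_def solid_invertible_def)
  define R' S' where "R' = Mat_inv d R" and "S' = Mat_inv d S"
  note Rc = Mat_inv_props(1,2)[OF Ru, folded R'_def]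
    and Sc = Mat_inv_props(1,2)[OF Su, folded S'_def]
  have R1: "R $$ (i, 0) = 1" and S1: "S $$ (i, 0) = 1" and R0: "R' $$ (0, i) \<noteq> 0"
    and Ri: "R' $$ (i, 0) = R' $$ (0, 0)" and Si: "S' $$ (i, 0) = S' $$ (0, 0)" if "i \<le> d" for i
    using R S that unfolding normalized_solid_invertible_def solid_invertible_def R'_def S'_def
    by blast+
  define c where "c k l = f (Delta d k l) $$ (k, l)" for k l
  have e: "S $$ (k, i) * S' $$ (i, l) = R $$ (k, i) * R' $$ (i, l) * c k l"
    if "i \<le> d" "k \<le> d" "l \<le> d" for i k l
  proof -
    have "R * Delta d i i * R' \<in> carrier_mat (Suc d) (Suc d)"
      using Rc by (auto intro!: mult_carrier_mat[of _ _ "Suc d"])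
    from alg_iso_fix_Delta[OF f fix_Delta this that(2,3)] show ?thesis
      unfolding R'_def S'_def fd[OF that(1)] c_def
      using that mult_Delta_mult_index[OF Rc that(1,1,2,3)] mult_Delta_mult_index[OF Sc that(1,1,2,3)]
      by (simp add: R'_def S'_def)
  qed
  \<comment> \<open>For \<open>i = 0\<close> the entries of \<open>R\<close> and \<open>S\<close> in
    column 0 are 1, so \<open>e\<close> reads \<open>S' $$ (0, l) = R' $$ (0, l) * c k l\<close>.
    The left side does not involve \<open>k\<close>, and \<open>R' $$ (0, l)\<close> is nonzero by
    solidity.\<close>
  have "c k l = c l l" if "k \<le> d" "l \<le> d" for k l
    using e[of 0 k l] e[of 0 l l] that R1 S1 R0 by simp
  moreover have "c l l = 1" if "l \<le> d" for l
    using fix_Delta[OF that] that by (simp add: c_def)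
  ultimately have c: "c k l = 1" if "k \<le> d" "l \<le> d" for k l
    using that by simp
  have r: "S' $$ (0, 0) = R' $$ (0, 0)"
    using e[of 0 0 0] c[of 0 0] R1 S1 by simp
  \<comment> \<open>Taking \<open>l = 0\<close> in \<open>e\<close>, the entries of
    \<open>S'\<close> and \<open>R'\<close> in column 0 all equal the common nonzero value
    \<open>R' $$ (0, 0)\<close> and cancel.\<close>
  have "S $$ (k, i) = R $$ (k, i)" if "k \<le> d" "i \<le> d" for k i
    using e[of i k 0] c[of k 0] that Ri[OF that(2)] Si[OF that(2)] r R0[of 0] by simp
  then show ?thesis
    using Rc Sc by (intro eq_matI) (auto simp: less_Suc_eq_le)
qed

section \<open>The bijection\<close>

lemma idempotent_system_Phi_normalized:
  assumes "R \<in> normalized_solid_invertible d"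
  shows "idempotent_system d (Phi d R)"
proof -
  have "solid_invertible d R"
    using assms unfolding normalized_solid_invertible_def by blast
  then show ?thesis
    using idempotent_system_Phi_iff unfolding solid_invertible_def by blast
qed

text \<open>Existence is diagonalization followed by normalization. For uniqueness, two normalized
  matrices representing \<open>\<Phi>\<close> give systems isomorphic to each other through
  \<open>\<Phi>\<close>.\<close>

lemma ex1_normalized_Phi_isomorphic:
  fixes \<Phi> :: "('a::field, 'b) idem_pair"
  assumes \<Phi>: "idempotent_system d \<Phi>"
  shows "\<exists>!R. R \<in> normalized_solid_invertible d \<and> idem_isomorphic d (Phi d R) \<Phi>"
proof -
  obtain W where W: "solid_invertible d W" "idem_isomorphic d \<Phi> (Phi d W)"
    using idempotent_system_isomorphic_Phi[OF \<Phi>] .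
  obtain R where R: "R \<in> normalized_solid_invertible d" "idem_isomorphic d (Phi d W) (Phi d R)"
    using solid_invertible_normalize[OF W(1)] .
  have \<Phi>R: "idem_isomorphic d \<Phi> (Phi d R)"
    using idem_isomorphic_trans[OF W(2) R(2)] .
  show ?thesis
  proof (intro ex1I[of _ R] conjI R(1) idem_isomorphic_sym[OF \<Phi> \<Phi>R])
    fix S
    assume "S \<in> normalized_solid_invertible d \<and> idem_isomorphic d (Phi d S) \<Phi>"
    then show "S = R"
      using normalized_Phi_isomorphic_eq[OF _ R(1)] idem_isomorphic_trans[OF _ \<Phi>R] by blast
  qed
qed

text \<open>The quotient in the first conjunct is formed over the carrier type of matrices; the
  second conjunct extends the correspondence to systems on an arbitrary carrier type
  \<open>'b\<close>.\<close>

theorem corollary6p5: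
  fixes d :: nat
  shows "bij_betw (\<lambda>R. idem_iso_class d (Phi d R))
           (normalized_solid_invertible d :: 'a::field mat set)
           (idem_iso_classes d :: ('a, 'a mat) idem_pair set set) \<and>
         (\<forall>\<Phi> :: ('a, 'b) idem_pair. idempotent_system d \<Phi> \<longrightarrow>
           (\<exists>!R. R \<in> normalized_solid_invertible d \<and> idem_isomorphic d (Phi d R) \<Phi>))"
proof (intro conjI allI impI bij_betwI')
  fix R S :: "'a mat"
  assume RS: "R \<in> normalized_solid_invertible d" "S \<in> normalized_solid_invertible d"
  then have "Phi d R \<in> idem_systems d" "Phi d S \<in> idem_systems d"
    by (simp_all add: idem_systems_def idempotent_system_Phi_normalized)
  then show "idem_iso_class d (Phi d R) = idem_iso_class d (Phi d S) \<longleftrightarrow> R = S"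
    using normalized_Phi_isomorphic_eq[OF RS] eq_equiv_class_iff[OF equiv_idem_iso_rel]
    by (auto simp: idem_iso_rel_def)
next
  fix R :: "'a mat"
  assume "R \<in> normalized_solid_invertible d"
  then show "idem_iso_class d (Phi d R) \<in> idem_iso_classes d"
    by (intro quotientI) (simp add: idem_systems_def idempotent_system_Phi_normalized)
next
  fix C :: "('a, 'a mat) idem_pair set"
  assume "C \<in> idem_iso_classes d"
  then obtain \<Phi> where \<Phi>: "\<Phi> \<in> idem_systems d" and C: "C = idem_iso_class d \<Phi>"
    by (auto elim: quotientE)
  obtain R where R: "R \<in> normalized_solid_invertible d" "idem_isomorphic d (Phi d R) \<Phi>"
    using ex1_normalized_Phi_isomorphic \<Phi> unfolding idem_systems_def by blast
  have "(Phi d R, \<Phi>) \<in> idem_iso_rel d"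
    using R \<Phi> by (simp add: idem_iso_rel_def idem_systems_def idempotent_system_Phi_normalized)
  then have "C = idem_iso_class d (Phi d R)"
    using C equiv_class_eq[OF equiv_idem_iso_rel] by metis
  then show "\<exists>R \<in> normalized_solid_invertible d. C = idem_iso_class d (Phi d R)"
    using R(1) by blast
qed (rule ex1_normalized_Phi_isomorphic)

end
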